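(* Let $(X,d)$ be a metric space with more than one element, let $M>0$, and let $d_A,d_{Am}:A\times A\to[0,\infty)$ be the associated functions on $A$. If $d$ is unbounded, then for every $M>0$ neither $d_A$ nor $d_{Am}$ is a metric on $A$. If $d$ is bounded and $\theta=\frac{\sup d}{M}$, then $d_A$ is a metric on $A$ if and only if $\theta\le 2$, and $d_{Am}$ is a metric on $A$ if and only if $\theta\le 2$.
   Context: $\mathbb{N}$ includes $0$. $A$ is the quotient of $X\times\mathbb{N}$ in which all points $(x,0)$, $x\in X$, are identified to a single point $e_0$; the class of $(x,r)$ is written $re_x$ (interpreted as $r$ copies of $x$), so $0e_x=e_0$ for all $x$. For $M>0$ define $$d_A(re_x,te_z)=M|t-r|+\min(r,t)\,d(x,z),$$ $$d_{Am}(re_x,te_z)=\frac{d_A(re_x,te_z)}{\max(r,t)}\ \text{ if }\max(r,t)>0,\qquad d_{Am}(e_0,e_0)=0.$$ These are well defined on $A\times A$. When $d$ is bounded, $\sup d$ denotes $\sup_{x,y\in X}d(x,y)$. *)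

theory Defs
  imports "HOL-Analysis.Analysis"
begin

definition copies_rel :: "'a \<times> nat \<Rightarrow> 'a \<times> nat \<Rightarrow> bool" where
  "copies_rel p q \<longleftrightarrow> p = q \<or> (snd p = 0 \<and> snd q = 0)"

quotient_type 'a copies = "'a \<times> nat" / copies_rel
  by (rule equivpI) (auto simp: copies_rel_def reflp_def symp_def transp_def)

(* The class of (x, r), i.e. r copies of x. *)
lift_definition mk_copies :: "nat \<Rightarrow> 'a \<Rightarrow> 'a copies" is "\<lambda>r x. (x, r)" .

lift_definition multiplicity_of :: "'a copies \<Rightarrow> nat" is snd
  by (auto simp: copies_rel_def)

(* The quotient of X x N for a carrier set X, as a subset of the quotient of the whole type. *)
definition copies_space :: "'a set \<Rightarrow> 'a copies set" where
  "copies_space X = {mk_copies r x | r x. x \<in> X}"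

(* Well defined for every function d, because min r t = 0 as soon as one of r, t is 0.
   The locale Metric_space demands nonnegativity and symmetry on the whole type, not only on the
   carrier; for M > 0 and Metric_space X d, the functions d_A M d and d_Am M d have both
   automatically, so Metric_space (copies_space X) imposes nothing off copies_space X. *)
lift_definition d_A :: "real \<Rightarrow> ('a \<Rightarrow> 'a \<Rightarrow> real) \<Rightarrow> 'a copies \<Rightarrow> 'a copies \<Rightarrow> real"
  is "\<lambda>M d (x, r) (z, t). M * \<bar>real t - real r\<bar> + real (min r t) * d x z"
  by (auto simp: copies_rel_def)

definition d_Am :: "real \<Rightarrow> ('a \<Rightarrow> 'a \<Rightarrow> real) \<Rightarrow> 'a copies \<Rightarrow> 'a copies \<Rightarrow> real" where
  "d_Am M d p q =
     (let m = max (multiplicity_of p) (multiplicity_of q)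
      in if m > 0 then d_A M d p q / real m else 0)"

lemma d_A_mk_copies:
  "d_A M d (mk_copies r x) (mk_copies t z) = M * \<bar>real t - real r\<bar> + real (min r t) * d x z"
  by transfer simp

lemma mk_copies_eq_iff: "mk_copies r x = mk_copies t z \<longleftrightarrow> (r = t \<and> (r = 0 \<or> x = z))"
  by transfer (auto simp: copies_rel_def)

lemma d_Am_mk_copies:
  "d_Am M d (mk_copies r x) (mk_copies t z) =
     (if max r t > 0 then d_A M d (mk_copies r x) (mk_copies t z) / real (max r t) else 0)"
proof -
  have "multiplicity_of (mk_copies k y) = k" for k and y :: 'a
    by transfer simp
  then show ?thesis
    by (simp add: d_Am_def Let_def)
qed

end

(* Going from e_x to e_y through e_0 costs 2 M in both functions, so each of them being a metric
   forces d <= 2 M on X.  Conversely assume d <= 2 M.  For d_A only a detour through fewer copies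
   is critical, and there each dropped copy saves at most d(x,z) <= 2 M but costs 2 M.  For d_Am a
   detour with at most max(r,t) copies reduces to d_A; otherwise, with r <= t <= s and c = d(x,z), the triangle inequality
   reduces to 0 <= (s - t) (M t + M r - r c), which holds since r c <= 2 M r <= M r + M t. *)
theory Submission
  imports Defs
begin

lemma mk_copies_cases:
  obtains r x where "p = mk_copies r x"
  by transfer (auto simp: copies_rel_def)

text \<open>All pairs with \<open>r = 0\<close> form one class, so there \<open>x\<close> cannot be
  recovered and only the nonemptiness of \<open>X\<close> matters.\<close>

lemma mk_copies_in_copies_space:
  "mk_copies r x \<in> copies_space X \<longleftrightarrow> (if r = 0 then X \<noteq> {} else x \<in> X)"
  unfolding copies_space_def by (auto simp: mk_copies_eq_iff)

lemma copies_space_cases: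
  assumes "p \<in> copies_space X"
  obtains r x where "x \<in> X" "p = mk_copies r x"
  using assms unfolding copies_space_def by auto

text \<open>The letters \<open>a\<close>, \<open>b\<close>, \<open>c\<close> stand for d(x,y),
  d(y,z), d(x,z). Symmetry will supply the case t < r.\<close>

lemma d_A_triangle_ordered:
  fixes r s t M a b c :: real
  assumes "0 \<le> r" "0 \<le> s" "r \<le> t" "0 \<le> b" "c \<le> a + b" "c \<le> 2 * M" "0 \<le> M"
  shows "M * \<bar>t - r\<bar> + min r t * c \<le> M * \<bar>s - r\<bar> + min r s * a + (M * \<bar>t - s\<bar> + min s t * b)"
proof (cases "r \<le> s")
  case True
  have "M * \<bar>t - r\<bar> \<le> M * (\<bar>s - r\<bar> + \<bar>t - s\<bar>)"
    using assms by (intro mult_left_mono) auto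
  moreover have "r * c \<le> r * (a + b)"
    using assms by (intro mult_left_mono) auto
  moreover have "r * b \<le> min s t * b"
    using assms True by (intro mult_right_mono) auto
  ultimately show ?thesis
    using assms True by (simp add: algebra_simps)
next
  case False
  have "s * c \<le> s * (a + b)"
    using assms by (intro mult_left_mono) auto
  \<comment> \<open>Descending to \<open>s\<close> and climbing to \<open>t\<close> costs M(r - s) +
    M(t - s), which exceeds M(t - r) by exactly 2M(r - s).\<close>
  moreover have "(r - s) * c \<le> (r - s) * (2 * M)"
    using assms False by (intro mult_left_mono) auto
  ultimately show ?thesis
    using assms False by (simp add: algebra_simps)
qed

lemma d_Am_triangle_ordered_above:
  fixes r s t M a b c :: real
  assumes "0 \<le> r" "r \<le> t" "0 < t" "t \<le> s" "0 \<le> b" "c \<le> a + b" "c \<le> 2 * M" "0 \<le> M"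
  shows "(M * \<bar>t - r\<bar> + min r t * c) / t
           \<le> (M * \<bar>s - r\<bar> + min r s * a) / s + (M * \<bar>t - s\<bar> + min s t * b) / s"
proof -
  have "r * c \<le> r * (2 * M)"
    using assms by (intro mult_left_mono) auto
  moreover have "M * r \<le> M * t"
    using assms by (intro mult_left_mono) auto
  \<comment> \<open>This product is the difference of the two sides of the cross-multiplied claim
    once \<open>r * a + t * b\<close> is replaced by its lower bound \<open>r * c\<close>.\<close>
  ultimately have "0 \<le> (s - t) * (M * t + M * r - r * c)"
    using assms by (intro mult_nonneg_nonneg) (auto simp: algebra_simps)
  then have "(M * (t - r) + r * c) * s \<le> (M * (s - r) + M * (s - t) + r * c) * t"
    by (simp add: algebra_simps)
  also have "r * c \<le> r * a + t * b"
  proof -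
    have "r * c \<le> r * (a + b)" "r * b \<le> t * b"
      using assms by (intro mult_left_mono mult_right_mono; simp)+
    then show ?thesis
      by (simp add: algebra_simps)
  qed
  then have "(M * (s - r) + M * (s - t) + r * c) * t
      \<le> (M * (s - r) + r * a + (M * (s - t) + t * b)) * t"
    using assms by (intro mult_right_mono) auto
  finally have "(M * (t - r) + r * c) / t \<le> (M * (s - r) + r * a + (M * (s - t) + t * b)) / s"
    using assms by (simp add: divide_simps)
  then show ?thesis
    using assms by (simp add: add_divide_distrib)
qed

context Metric_space
begin

lemma d_A_commute: "d_A K d p q = d_A K d q p"
  by (cases p rule: mk_copies_cases; cases q rule: mk_copies_cases)
     (simp add: d_A_mk_copies commute min.commute abs_minus_commute)

lemma d_Am_commute: "d_Am K d p q = d_Am K d q p"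
  by (simp add: d_Am_def Let_def d_A_commute[of K p] max.commute)

lemma d_A_nonneg: "0 \<le> K \<Longrightarrow> 0 \<le> d_A K d p q"
  by (cases p rule: mk_copies_cases; cases q rule: mk_copies_cases) (simp add: d_A_mk_copies)

lemma d_Am_nonneg: "0 \<le> K \<Longrightarrow> 0 \<le> d_Am K d p q"
  by (simp add: d_Am_def Let_def d_A_nonneg)

lemma d_A_eq_0_iff:
  assumes "0 < K" "p \<in> copies_space M" "q \<in> copies_space M"
  shows "d_A K d p q = 0 \<longleftrightarrow> p = q"
proof -
  obtain r x t z where *: "x \<in> M" "p = mk_copies r x" "z \<in> M" "q = mk_copies t z"
    using assms by (meson copies_space_cases)
  have "d_A K d p q = 0 \<longleftrightarrow> K * \<bar>real t - real r\<bar> = 0 \<and> real (min r t) * d x z = 0"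
    unfolding * d_A_mk_copies using \<open>0 < K\<close> by (intro add_nonneg_eq_0_iff) auto
  \<comment> \<open>The first summand forces \<open>r = t\<close>. Then \<open>min r t\<close> is
    \<open>r\<close>, and what remains is \<open>r = 0\<close> or \<open>x = z\<close>, which is
    equality of classes.\<close>
  also have "\<dots> \<longleftrightarrow> p = q"
    using * \<open>0 < K\<close> by (auto simp: mk_copies_eq_iff min_def)
  finally show ?thesis .
qed

lemma d_Am_eq_0_iff:
  assumes "0 < K" "p \<in> copies_space M" "q \<in> copies_space M"
  shows "d_Am K d p q = 0 \<longleftrightarrow> p = q"
proof -
  obtain r x t z where *: "p = mk_copies r x" "q = mk_copies t z"
    using assms by (meson copies_space_cases)
  show ?thesis
  proof (cases "max r t > 0")
    case True
    then show ?thesis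
      using d_A_eq_0_iff[OF assms] unfolding * d_Am_mk_copies by auto
  next
    case False
    then show ?thesis
      unfolding * d_Am_mk_copies by (simp add: mk_copies_eq_iff)
  qed
qed

lemma Metric_space_d_A:
  assumes "0 < K" and bound: "\<And>x y. \<lbrakk>x \<in> M; y \<in> M\<rbrakk> \<Longrightarrow> d x y \<le> 2 * K"
  shows "Metric_space (copies_space M) (d_A K d)"
proof
  fix p q w :: "'a copies"
  show "0 \<le> d_A K d p q" "d_A K d p q = d_A K d q p"
    using \<open>0 < K\<close> by (simp_all add: d_A_nonneg d_A_commute[of K p])
  assume pq: "p \<in> copies_space M" "q \<in> copies_space M"
  then show "d_A K d p q = 0 \<longleftrightarrow> p = q"
    by (rule d_A_eq_0_iff[OF \<open>0 < K\<close>])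
  assume "w \<in> copies_space M"
  with pq obtain r x s y t z where *: "x \<in> M" "p = mk_copies r x" "y \<in> M" "q = mk_copies s y"
      "z \<in> M" "w = mk_copies t z"
    by (meson copies_space_cases)
  \<comment> \<open>The endpoints are generalised while the middle point stays fixed, so that the
    case \<open>t < r\<close> follows by swapping them.\<close>
  have ordered: "d_A K d (mk_copies r x) (mk_copies t z)
      \<le> d_A K d (mk_copies r x) (mk_copies s y) + d_A K d (mk_copies s y) (mk_copies t z)"
    if "r \<le> t" "x \<in> M" "z \<in> M" for r x t z
    unfolding d_A_mk_copies of_nat_min
    using that \<open>y \<in> M\<close> \<open>0 < K\<close> bound triangle by (intro d_A_triangle_ordered) auto
  show "d_A K d p w \<le> d_A K d p q + d_A K d q w"
    using ordered[of r t x z] ordered[of t r z x] * d_A_commute by (cases "r \<le> t") (simp_all add: ac_simps)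
qed

lemma d_Am_triangle_ordered:
  assumes "0 < K" and bound: "\<And>x y. \<lbrakk>x \<in> M; y \<in> M\<rbrakk> \<Longrightarrow> d x y \<le> 2 * K"
    and "x \<in> M" "y \<in> M" "z \<in> M" and "r \<le> t"
  shows "d_Am K d (mk_copies r x) (mk_copies t z)
    \<le> d_Am K d (mk_copies r x) (mk_copies s y) + d_Am K d (mk_copies s y) (mk_copies t z)"
proof -
  let ?p = "mk_copies r x" and ?q = "mk_copies s y" and ?w = "mk_copies t z"
  interpret A: Metric_space "copies_space M" "d_A K d"
    using assms by (intro Metric_space_d_A) auto
  consider "t = 0" | "0 < t" "s \<le> t" | "0 < t" "t \<le> s"
    by linarith
  then show ?thesis
  proof cases
    \<comment> \<open>Here \<open>r = t = 0\<close>, so the left side is the default value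
      0.\<close>
    case 1
    then show ?thesis
      using assms d_Am_nonneg by (simp add: d_Am_mk_copies)
  next
    case 2
    have "d_A K d ?p ?w \<le> d_A K d ?p ?q + d_A K d ?q ?w"
      using assms by (intro A.triangle) (auto simp: mk_copies_in_copies_space)
    then have "d_A K d ?p ?w / real t \<le> d_A K d ?p ?q / real t + d_A K d ?q ?w / real t"
      by (simp add: add_divide_distrib [symmetric] divide_right_mono)
    \<comment> \<open>The true denominator \<open>max r s\<close> is at most \<open>t\<close>, so
      using it only enlarges the quotient. The other summand has denominator \<open>t\<close>
      already.\<close>
    moreover have "d_A K d ?p ?q / real t \<le> d_Am K d ?p ?q"
    proof (cases "max r s > 0")
      case True
      then show ?thesis
        using 2 \<open>r \<le> t\<close> by (auto simp: d_Am_mk_copies intro!: divide_left_mono)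
    next
      \<comment> \<open>Now \<open>r = s = 0\<close>: the numerator vanishes too and agrees with the
        default 0.\<close>
      case False
      then show ?thesis
        by (simp add: d_A_mk_copies d_Am_mk_copies)
    qed
    ultimately show ?thesis
      using 2 \<open>r \<le> t\<close> by (simp add: d_Am_mk_copies max_absorb2)
  next
    case 3
    then show ?thesis
      using d_Am_triangle_ordered_above[of "real r" "real t" "real s" "d y z" "d x z" "d x y" K]
        assms triangle[of x y z]
      by (simp add: d_Am_mk_copies d_A_mk_copies of_nat_min max_absorb1 max_absorb2)
  qed
qed

lemma Metric_space_d_Am:
  assumes "0 < K" and bound: "\<And>x y. \<lbrakk>x \<in> M; y \<in> M\<rbrakk> \<Longrightarrow> d x y \<le> 2 * K"
  shows "Metric_space (copies_space M) (d_Am K d)"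
proof
  fix p q w :: "'a copies"
  show "0 \<le> d_Am K d p q" "d_Am K d p q = d_Am K d q p"
    using \<open>0 < K\<close> by (simp_all add: d_Am_nonneg d_Am_commute[of K p])
  assume pq: "p \<in> copies_space M" "q \<in> copies_space M"
  then show "d_Am K d p q = 0 \<longleftrightarrow> p = q"
    by (rule d_Am_eq_0_iff[OF \<open>0 < K\<close>])
  assume "w \<in> copies_space M"
  with pq obtain r x s y t z where *: "x \<in> M" "p = mk_copies r x" "y \<in> M" "q = mk_copies s y"
      "z \<in> M" "w = mk_copies t z"
    by (meson copies_space_cases)
  show "d_Am K d p w \<le> d_Am K d p q + d_Am K d q w"
    using d_Am_triangle_ordered[OF assms, of x y z r t s] d_Am_triangle_ordered[OF assms, of z y x t r s]
      * d_Am_commute by (cases "r \<le> t") (simp_all add: ac_simps)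
qed

text \<open>The pointwise bound avoids the supremum and so serves bounded and unbounded
  \<open>d\<close> alike.\<close>

lemma Metric_space_d_A_iff:
  assumes "0 < K"
  shows "Metric_space (copies_space M) (d_A K d) \<longleftrightarrow> (\<forall>x\<in>M. \<forall>y\<in>M. d x y \<le> 2 * K)"
proof (intro iffI ballI)
  fix x y
  assume "Metric_space (copies_space M) (d_A K d)" and xy: "x \<in> M" "y \<in> M"
  then interpret A: Metric_space "copies_space M" "d_A K d"
    by simp
  have "d_A K d (mk_copies 1 x) (mk_copies 1 y)
      \<le> d_A K d (mk_copies 1 x) (mk_copies 0 x) + d_A K d (mk_copies 0 x) (mk_copies 1 y)"
    using xy by (intro A.triangle) (auto simp: mk_copies_in_copies_space)
  then show "d x y \<le> 2 * K"
    by (simp add: d_A_mk_copies)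
qed (use assms Metric_space_d_A in blast)

lemma Metric_space_d_Am_iff:
  assumes "0 < K"
  shows "Metric_space (copies_space M) (d_Am K d) \<longleftrightarrow> (\<forall>x\<in>M. \<forall>y\<in>M. d x y \<le> 2 * K)"
proof (intro iffI ballI)
  fix x y
  assume "Metric_space (copies_space M) (d_Am K d)" and xy: "x \<in> M" "y \<in> M"
  then interpret A: Metric_space "copies_space M" "d_Am K d"
    by simp
  \<comment> \<open>All three maxima are 1, so the normalisation changes nothing on this
    triangle.\<close>
  have "d_Am K d (mk_copies 1 x) (mk_copies 1 y)
      \<le> d_Am K d (mk_copies 1 x) (mk_copies 0 x) + d_Am K d (mk_copies 0 x) (mk_copies 1 y)"
    using xy by (intro A.triangle) (auto simp: mk_copies_in_copies_space)
  then show "d x y \<le> 2 * K"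
    by (simp add: d_Am_mk_copies d_A_mk_copies)
qed (use assms Metric_space_d_Am in blast)

end

theorem proposition8:
  fixes X :: "'a set" and d :: "'a \<Rightarrow> 'a \<Rightarrow> real"
  assumes "Metric_space X d"
    and "\<exists>x\<in>X. \<exists>y\<in>X. x \<noteq> y"
  shows "(\<not> bounded ((\<lambda>(x, y). d x y) ` (X \<times> X)) \<longrightarrow>
           (\<forall>M>0. \<not> Metric_space (copies_space X) (d_A M d) \<and>
                  \<not> Metric_space (copies_space X) (d_Am M d))) \<and>
         (bounded ((\<lambda>(x, y). d x y) ` (X \<times> X)) \<longrightarrow>
           (\<forall>M>0. \<forall>\<theta>. \<theta> = (SUP (x, y)\<in>X \<times> X. d x y) / M \<longrightarrow>
              (Metric_space (copies_space X) (d_A M d) \<longleftrightarrow> \<theta> \<le> 2) \<and>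
              (Metric_space (copies_space X) (d_Am M d) \<longleftrightarrow> \<theta> \<le> 2)))"
proof -
  interpret X: Metric_space X d
    by fact
  let ?D = "(\<lambda>(x, y). d x y) ` (X \<times> X)"
  \<comment> \<open>Since \<open>d\<close> is nonnegative, an upper bound suffices. By
    contraposition, an unbounded \<open>d\<close> breaks the criterion for every
    \<open>M\<close>.\<close>
  have bounded_D: "bounded ?D" if "\<forall>x\<in>X. \<forall>y\<in>X. d x y \<le> 2 * M" for M
    using that by (intro boundedI[where B = "2 * M"]) auto
  have le_iff: "(SUP (x, y)\<in>X \<times> X. d x y) / M \<le> 2 \<longleftrightarrow> (\<forall>x\<in>X. \<forall>y\<in>X. d x y \<le> 2 * M)"
    if "bounded ?D" "0 < M" for M
  proof -
    have "X \<times> X \<noteq> {}"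
      using assms(2) by auto
    \<comment> \<open>A real supremum is a least upper bound only for a nonempty set bounded above;
      both conditions are at hand.\<close>
    then have "(SUP (x, y)\<in>X \<times> X. d x y) \<le> 2 * M \<longleftrightarrow> (\<forall>x\<in>X. \<forall>y\<in>X. d x y \<le> 2 * M)"
      using bounded_imp_bdd_above[OF that(1)] by (subst cSUP_le_iff) auto
    then show ?thesis
      using \<open>0 < M\<close> by (simp add: pos_divide_le_eq)
  qed
  show ?thesis
    using bounded_D le_iff X.Metric_space_d_A_iff X.Metric_space_d_Am_iff by blast
qed

end
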